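(* Let $N\ge2$ and let $(\mu,(f_i)_{i\in\mathbb{Z}_N})$ be a nonnegative monic system. Let $(S_i)_{i\in\mathbb{Z}_N}$ be the associated monic representation of $\mathcal{O}_N$ on $L^2(\mu)$, and let $(S_i^u)_{i\in\mathbb{Z}_N}$ be the universal representation of $\mathcal{O}_N$ on the space $\mathcal{H}(\mathcal{K}_N)$ of $\sigma$-functions. Then the map $W$ from $L^2(\mu)$ to $\mathcal{H}(\mathcal{K}_N)$ given by $Wf=f\sqrt{d\mu}$ defines an isometric embedding which intertwines the two representations: $WS_i=S_i^uW$ for all $i\in\mathbb{Z}_N$.
   Context: Let $\mathbb{Z}_N=\{0,1,\dots,N-1\}$. A representation of $\mathcal{O}_N$ on a Hilbert space is a family of isometries $(S_i)_{i\in\mathbb{Z}_N}$ with $S_i^*S_j=\delta_{ij}I$ and $\sum_{i}S_iS_i^*=I$. Let $\mathcal{K}_N=\prod_1^\infty\mathbb{Z}_N$ be the compact space of infinite words (product topology), $\sigma(\omega_1\omega_2\dots)=\omega_2\omega_3\dots$, and $\sigma_i(\omega_1\omega_2\dots)=i\omega_1\omega_2\dots$ for $i\in\mathbb{Z}_N$. $\mu\circ\sigma_i^{-1}$ denotes the push-forward $A\mapsto\mu(\sigma_i^{-1}(A))$. A monic system is a pair $(\mu,(f_i)_{i\in\mathbb{Z}_N})$ where $\mu$ is a finite Borel measure on $\mathcal{K}_N$ with $\mu\circ\sigma_i^{-1}\ll\mu$ for all $i$, and $f_i\in L^2(\mu)$ are functions such that $\frac{d(\mu\circ\sigma_i^{-1})}{d\mu}=|f_i|^2$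 and $f_i(x)\ne0$ for $\mu$-a.e. $x\in\sigma_i(\mathcal{K}_N)$. It is nonnegative if $f_i\ge0$ for all $i$. The representation of $\mathcal{O}_N$ associated to it is the one on $L^2(\mu)$ given by $S_if=f_i\,(f\circ\sigma)$. The Hilbert space $\mathcal{H}(\mathcal{K}_N)$ of $\sigma$-functions: consider pairs $(f,\mu)$ with $\mu$ a finite Borel measure on $\mathcal{K}_N$ and $f\in L^2(\mu)$. Say $(f,\mu)\sim(g,\nu)$ if there is a (finite Borel) measure $\lambda$ with $\mu,\nu\ll\lambda$ and $f\sqrt{\frac{d\mu}{d\lambda}}=g\sqrt{\frac{d\nu}{d\lambda}}$ $\lambda$-a.e. The class of $(f,\mu)$ is denoted $f\sqrt{d\mu}$; $\mathcal{H}(\mathcal{K}_N)$ is the set of all classes, with addition $f\sqrt{d\mu}+g\sqrt{d\nu}=\big(f\sqrt{\frac{d\mu}{d\lambda}}+g\sqrt{\frac{d\nu}{d\lambda}}\big)\sqrt{d\lambda}$ and inner product $\langle f\sqrt{d\mu},g\sqrt{d\nu}\rangle=\int\overline{f}g\sqrt{\frac{d\mu}{d\lambda}}\sqrt{\frac{d\nu}{d\lambda}}\,d\lambda$, for any $\lambda$ with $\mu,\nu\ll\lambda$. The universal representation of $\mathcal{O}_N$ on $\mathcal{H}(\mathcal{K}_N)$ is given by $S_i^u(f\sqrt{d\mu})=(f\circ\sigma)\sqrt{d(\mu\circ\sigma_i^{-1})}$. *)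

theory Defs
  imports "HOL-Analysis.Analysis"
begin

type_synonym infword = "nat \<Rightarrow> nat"

definition words :: "nat \<Rightarrow> infword set" where
  "words N = {w. \<forall>k. w k < N}"

text \<open>The topology on \<^typ>\<open>nat \<Rightarrow> nat\<close> is the product of discrete topologies, so restricting
  its Borel sets gives the Borel sets of the compact space of infinite words.\<close>

definition word_borel :: "nat \<Rightarrow> infword measure" where
  "word_borel N = restrict_space borel (words N)"

definition shift :: "infword \<Rightarrow> infword" where
  "shift w = (\<lambda>k. w (Suc k))"

definition prepend :: "nat \<Rightarrow> infword \<Rightarrow> infword" where
  "prepend i w = case_nat i w"

definition finite_borel :: "nat \<Rightarrow> infword measure \<Rightarrow> bool" where
  "finite_borel N \<mu> \<longleftrightarrow> sets \<mu> = sets (word_borel N) \<and> finite_measure \<mu>"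

definition push :: "nat \<Rightarrow> nat \<Rightarrow> infword measure \<Rightarrow> infword measure" where
  "push N i \<mu> = distr \<mu> (word_borel N) (prepend i)"


text \<open>Complex inner product spaces on an explicit carrier. The inner product is conjugate-linear
  in the first argument.\<close>

record 'a cip_space =
  vecs :: "'a set"
  vadd :: "'a \<Rightarrow> 'a \<Rightarrow> 'a"
  vscale :: "complex \<Rightarrow> 'a \<Rightarrow> 'a"
  vinner :: "'a \<Rightarrow> 'a \<Rightarrow> complex"

definition isometric_embedding ::
    "'a cip_space \<Rightarrow> 'b cip_space \<Rightarrow> ('a \<Rightarrow> 'b) \<Rightarrow> bool" where
  "isometric_embedding V V' T \<longleftrightarrow>
     (\<forall>a \<in> vecs V. T a \<in> vecs V') \<and>
     (\<forall>a \<in> vecs V. \<forall>b \<in> vecs V. T (vadd V a b) = vadd V' (T a) (T b)) \<and>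
     (\<forall>c. \<forall>a \<in> vecs V. T (vscale V c a) = vscale V' c (T a)) \<and>
     (\<forall>a \<in> vecs V. \<forall>b \<in> vecs V. vinner V' (T a) (T b) = vinner V a b) \<and>
     inj_on T (vecs V)"


definition sq_integrable :: "'a measure \<Rightarrow> ('a \<Rightarrow> complex) set" where
  "sq_integrable M = {f. f \<in> borel_measurable M \<and> integrable M (\<lambda>x. (cmod (f x))\<^sup>2)}"

definition ae_rel :: "'a measure \<Rightarrow> (('a \<Rightarrow> complex) \<times> ('a \<Rightarrow> complex)) set" where
  "ae_rel M = {(f, g). f \<in> sq_integrable M \<and> g \<in> sq_integrable M \<and> (AE x in M. f x = g x)}"

definition L2_class :: "'a measure \<Rightarrow> ('a \<Rightarrow> complex) \<Rightarrow> ('a \<Rightarrow> complex) set" where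
  "L2_class M f = ae_rel M `` {f}"

text \<open>Operations on classes, here and below, are defined through all representatives: as the union
  of the resulting classes, or as the unique number obtained from every choice.\<close>

definition L2 :: "'a measure \<Rightarrow> ('a \<Rightarrow> complex) set cip_space" where
  "L2 M = \<lparr>
     vecs = sq_integrable M // ae_rel M,
     vadd = (\<lambda>a b. \<Union>f\<in>a. \<Union>g\<in>b. L2_class M (\<lambda>x. f x + g x)),
     vscale = (\<lambda>c a. \<Union>f\<in>a. L2_class M (\<lambda>x. c * f x)),
     vinner = (\<lambda>a b. THE z. \<forall>f\<in>a. \<forall>g\<in>b. z = (\<integral>x. cnj (f x) * g x \<partial>M)) \<rparr>"


definition monic_system ::
    "nat \<Rightarrow> infword measure \<Rightarrow> (nat \<Rightarrow> infword \<Rightarrow> complex) \<Rightarrow> bool" where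
  "monic_system N \<mu> f \<longleftrightarrow>
     finite_borel N \<mu> \<and>
     (\<forall>i<N. absolutely_continuous \<mu> (push N i \<mu>) \<and>
            f i \<in> sq_integrable \<mu> \<and>
            (AE x in \<mu>. RN_deriv \<mu> (push N i \<mu>) x = ennreal ((cmod (f i x))\<^sup>2)) \<and>
            (AE x in \<mu>. x \<in> prepend i ` words N \<longrightarrow> f i x \<noteq> 0))"

definition nonneg_monic_system ::
    "nat \<Rightarrow> infword measure \<Rightarrow> (nat \<Rightarrow> infword \<Rightarrow> complex) \<Rightarrow> bool" where
  "nonneg_monic_system N \<mu> f \<longleftrightarrow>
     monic_system N \<mu> f \<and> (\<forall>i<N. AE x in \<mu>. f i x \<in> \<real>\<^sub>\<ge>\<^sub>0)"

definition monic_op ::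
    "infword measure \<Rightarrow> (nat \<Rightarrow> infword \<Rightarrow> complex) \<Rightarrow> nat
      \<Rightarrow> (infword \<Rightarrow> complex) set \<Rightarrow> (infword \<Rightarrow> complex) set" where
  "monic_op \<mu> f i a = (\<Union>g\<in>a. L2_class \<mu> (\<lambda>x. f i x * g (shift x)))"


type_synonym sigma_pair = "(infword \<Rightarrow> complex) \<times> infword measure"

definition sigma_pairs :: "nat \<Rightarrow> sigma_pair set" where
  "sigma_pairs N = {(f, \<mu>). finite_borel N \<mu> \<and> f \<in> sq_integrable \<mu>}"

definition dominating :: "nat \<Rightarrow> infword measure \<Rightarrow> infword measure \<Rightarrow> infword measure set" where
  "dominating N \<mu> \<nu> =
     {\<rho>. finite_borel N \<rho> \<and> absolutely_continuous \<rho> \<mu> \<and> absolutely_continuous \<rho> \<nu>}"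

definition sqrt_deriv :: "infword measure \<Rightarrow> infword measure \<Rightarrow> infword \<Rightarrow> complex" where
  "sqrt_deriv \<mu> \<rho> x = complex_of_real (sqrt (enn2real (RN_deriv \<rho> \<mu> x)))"

definition sigma_rel :: "nat \<Rightarrow> (sigma_pair \<times> sigma_pair) set" where
  "sigma_rel N = {((f, \<mu>), (g, \<nu>)).
     (f, \<mu>) \<in> sigma_pairs N \<and> (g, \<nu>) \<in> sigma_pairs N \<and>
     (\<exists>\<rho> \<in> dominating N \<mu> \<nu>.
        AE x in \<rho>. f x * sqrt_deriv \<mu> \<rho> x = g x * sqrt_deriv \<nu> \<rho> x)}"

definition sigma_fun :: "nat \<Rightarrow> (infword \<Rightarrow> complex) \<Rightarrow> infword measure \<Rightarrow> sigma_pair set" where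
  "sigma_fun N f \<mu> = sigma_rel N `` {(f, \<mu>)}"

definition sigma_space :: "nat \<Rightarrow> sigma_pair set cip_space" where
  "sigma_space N = \<lparr>
     vecs = sigma_pairs N // sigma_rel N,
     vadd = (\<lambda>a b. \<Union>(f, \<mu>)\<in>a. \<Union>(g, \<nu>)\<in>b. \<Union>\<rho>\<in>dominating N \<mu> \<nu>.
        sigma_fun N (\<lambda>x. f x * sqrt_deriv \<mu> \<rho> x + g x * sqrt_deriv \<nu> \<rho> x) \<rho>),
     vscale = (\<lambda>c a. \<Union>(f, \<mu>)\<in>a. sigma_fun N (\<lambda>x. c * f x) \<mu>),
     vinner = (\<lambda>a b. THE z. \<forall>(f, \<mu>)\<in>a. \<forall>(g, \<nu>)\<in>b. \<forall>\<rho>\<in>dominating N \<mu> \<nu>.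
        z = (\<integral>x. cnj (f x) * g x * sqrt_deriv \<mu> \<rho> x * sqrt_deriv \<nu> \<rho> x \<partial>\<rho>)) \<rparr>"

definition universal_op :: "nat \<Rightarrow> nat \<Rightarrow> sigma_pair set \<Rightarrow> sigma_pair set" where
  "universal_op N i a = (\<Union>(f, \<mu>)\<in>a. sigma_fun N (f \<circ> shift) (push N i \<mu>))"

definition W_map :: "nat \<Rightarrow> infword measure \<Rightarrow> (infword \<Rightarrow> complex) set \<Rightarrow> sigma_pair set" where
  "W_map N \<mu> a = (\<Union>f\<in>a. sigma_fun N f \<mu>)"

end

theory Submission imports Defs begin

text \<open>The main tool is the chain rule
  \<open>\<surd>(d\<mu>/d\<tau>) = \<surd>(d\<mu>/d\<rho>) \<cdot> \<surd>(d\<rho>/d\<tau>)\<close> for \<open>\<mu> \<lless> \<rho> \<lless> \<tau>\<close>: it lets one compare two dominating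
  measures through a common one, so that equivalence of pairs, sums and inner products may be
  computed with respect to any dominating measure. For vectors in the image of \<open>W\<close> that measure
  is taken to be \<open>\<mu>\<close> itself. For the intertwining relation, nonnegativity of \<open>f i\<close> makes it
  equal to \<open>\<surd>(d(\<mu> \<circ> \<sigma>\<^sub>i\<inverse>)/d\<mu>)\<close>, so
  \<open>f i (g \<circ> \<sigma>) \<surd>d\<mu> = (g \<circ> \<sigma>) \<surd>d(\<mu> \<circ> \<sigma>\<^sub>i\<inverse>)\<close>.\<close>

section \<open>Finite Borel measures on the word space and absolute continuity\<close>

lemma finite_borel_sets: "finite_borel N \<mu> \<Longrightarrow> sets \<mu> = sets (word_borel N)"
  by (simp add: finite_borel_def)

lemma finite_borel_measurable:
  "finite_borel N \<mu> \<Longrightarrow> measurable \<mu> M = measurable (word_borel N) M"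
  by (intro measurable_cong_sets finite_borel_sets refl)

lemma finite_borel_imp_finite: "finite_borel N \<mu> \<Longrightarrow> finite_measure \<mu>"
  by (simp add: finite_borel_def)

lemma finite_borel_imp_sigma_finite: "finite_borel N \<mu> \<Longrightarrow> sigma_finite_measure \<mu>"
  using finite_borel_imp_finite by (simp add: finite_measure_def)

lemma absolutely_continuous_refl: "absolutely_continuous \<mu> \<mu>"
  by (simp add: absolutely_continuous_def)

lemma absolutely_continuous_trans:
  "absolutely_continuous \<tau> \<rho> \<Longrightarrow> absolutely_continuous \<rho> \<mu> \<Longrightarrow> absolutely_continuous \<tau> \<mu>"
  by (auto simp: absolutely_continuous_def)

text \<open>The lattice supremum of the two measures is a witness: it lies above both, so its null
  sets are null for both. Common dominating measures serve to compare two given ones and to keep the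
  unions over \<open>dominating\<close> nonempty.\<close>

lemma dominating_nonempty:
  assumes "finite_borel N \<mu>" "finite_borel N \<nu>"
  shows "dominating N \<mu> \<nu> \<noteq> {}"
proof -
  let ?\<rho> = "sup_measure' \<mu> \<nu>"
  have eq: "sets \<nu> = sets \<mu>"
    using assms by (simp add: finite_borel_sets)
  have space_eq: "space \<nu> = space \<mu>"
    using eq by (rule sets_eq_imp_space_eq)
  have le: "emeasure \<mu> A \<le> emeasure ?\<rho> A" "emeasure \<nu> A \<le> emeasure ?\<rho> A" if "A \<in> sets \<mu>" for A
    using le_emeasure_sup_measure'1[OF eq that] le_emeasure_sup_measure'2[OF eq that] by auto
  interpret \<mu>: finite_measure \<mu> using assms(1) by (rule finite_borel_imp_finite)
  interpret \<nu>: finite_measure \<nu> using assms(2) by (rule finite_borel_imp_finite)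
  \<comment> \<open>The supremum measure of a set is the supremum, over its measurable splittings
    into two pieces, of the \<open>\<mu>\<close>-mass of one piece plus the
    \<open>\<nu>\<close>-mass of the other. Each such sum is at most the sum of the total
    masses.\<close>
  have "emeasure ?\<rho> (space \<mu>) \<le> emeasure \<mu> (space \<mu>) + emeasure \<nu> (space \<nu>)"
    by (subst emeasure_sup_measure'[OF eq])
       (auto intro!: SUP_least add_mono emeasure_mono dest: sets.sets_into_space simp: eq space_eq)
  also have "\<dots> < \<infinity>"
    using \<mu>.emeasure_finite \<nu>.emeasure_finite by (simp flip: less_top)
  finally have "finite_measure ?\<rho>"
    by (intro finite_measureI) (auto simp: space_sup_measure'[OF eq])
  then have "finite_borel N ?\<rho>"
    using assms by (simp add: finite_borel_def sets_sup_measure'[OF eq])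
  moreover have "absolutely_continuous ?\<rho> \<mu>" "absolutely_continuous ?\<rho> \<nu>"
    using le eq by (auto simp: absolutely_continuous_def null_sets_def sets_sup_measure'[OF eq])
      (metis le_zero_eq)+
  ultimately show ?thesis
    by (auto simp: dominating_def)
qed

section \<open>Square roots of Radon-Nikodym derivatives\<close>

lemma sqrt_deriv_measurable: "sqrt_deriv \<mu> \<rho> \<in> borel_measurable \<rho>"
  unfolding sqrt_deriv_def[abs_def] by measurable

lemma sqrt_deriv_measurable_word_borel:
  "finite_borel N \<rho> \<Longrightarrow> sqrt_deriv \<mu> \<rho> \<in> borel_measurable (word_borel N)"
  using sqrt_deriv_measurable finite_borel_measurable by blast

lemma cnj_sqrt_deriv [simp]: "cnj (sqrt_deriv \<mu> \<rho> x) = sqrt_deriv \<mu> \<rho> x"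
  by (simp add: sqrt_deriv_def)

text \<open>Radon-Nikodym derivatives are unique almost everywhere, and nonnegativity of
  \<open>g\<close> makes the square root undo the square. Later formulas for
  \<open>sqrt_deriv\<close> are obtained from this by exhibiting a suitable density.\<close>

lemma sqrt_deriv_eqI:
  assumes "finite_borel N \<rho>" "g \<in> borel_measurable \<rho>" "\<And>x. 0 \<le> g x"
    and "density \<rho> (\<lambda>x. ennreal ((g x)\<^sup>2)) = \<mu>"
  shows "AE x in \<rho>. sqrt_deriv \<mu> \<rho> x = complex_of_real (g x)"
proof -
  interpret sigma_finite_measure \<rho>
    using assms(1) by (rule finite_borel_imp_sigma_finite)
  have "AE x in \<rho>. ennreal ((g x)\<^sup>2) = RN_deriv \<rho> \<mu> x"
    using assms by (intro RN_deriv_unique) auto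
  then show ?thesis
  proof eventually_elim
    case (elim x)
    then show ?case
      using assms(3)[of x] by (simp add: sqrt_deriv_def flip: elim)
  qed
qed

text \<open>\<open>enn2real\<close> sends infinity to 0, so squaring the root recovers the
  derivative only where the derivative is finite. Since \<open>\<mu>\<close> is sigma-finite, this
  is the case almost everywhere.\<close>

lemma density_sqrt_deriv:
  assumes "finite_borel N \<rho>" "finite_borel N \<mu>" "absolutely_continuous \<rho> \<mu>"
  shows "density \<rho> (\<lambda>x. ennreal ((cmod (sqrt_deriv \<mu> \<rho> x))\<^sup>2)) = \<mu>"
proof -
  interpret sigma_finite_measure \<rho>
    using assms(1) by (rule finite_borel_imp_sigma_finite)
  have sets: "sets \<mu> = sets \<rho>"
    using assms by (simp add: finite_borel_sets)
  have "AE x in \<rho>. RN_deriv \<rho> \<mu> x \<noteq> \<infinity>"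
    using assms finite_borel_imp_sigma_finite sets by (intro RN_deriv_finite) auto
  then have "AE x in \<rho>. ennreal ((cmod (sqrt_deriv \<mu> \<rho> x))\<^sup>2) = RN_deriv \<rho> \<mu> x"
    by eventually_elim (simp add: sqrt_deriv_def less_top)
  then have "density \<rho> (\<lambda>x. ennreal ((cmod (sqrt_deriv \<mu> \<rho> x))\<^sup>2)) = density \<rho> (RN_deriv \<rho> \<mu>)"
    using sqrt_deriv_measurable[of \<mu> \<rho>] by (intro density_cong) auto
  also have "\<dots> = \<mu>"
    using assms(3) sets by (rule density_RN_deriv)
  finally show ?thesis .
qed

text \<open>The density of \<open>\<mu>\<close> is the squared modulus of the root, so
  \<open>\<mu>\<close> only sees points where the root does not vanish.\<close>

lemma AE_iff_AE_sqrt_deriv: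
  assumes "finite_borel N \<rho>" "finite_borel N \<mu>" "absolutely_continuous \<rho> \<mu>"
  shows "(AE x in \<mu>. P x) \<longleftrightarrow> (AE x in \<rho>. sqrt_deriv \<mu> \<rho> x \<noteq> 0 \<longrightarrow> P x)"
  using sqrt_deriv_measurable[of \<mu> \<rho>]
  by (subst density_sqrt_deriv[OF assms, symmetric], subst AE_density) auto

text \<open>Two successive densities multiply. This displays \<open>\<mu>\<close> as a density over
  \<open>\<tau>\<close> whose root is the product, and uniqueness identifies that root.\<close>

lemma sqrt_deriv_chain:
  assumes "finite_borel N \<tau>" "finite_borel N \<rho>" "finite_borel N \<mu>"
    and "absolutely_continuous \<tau> \<rho>" "absolutely_continuous \<rho> \<mu>"
  shows "AE x in \<tau>. sqrt_deriv \<mu> \<tau> x = sqrt_deriv \<mu> \<rho> x * sqrt_deriv \<rho> \<tau> x"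
proof -
  have [measurable]: "sqrt_deriv \<mu> \<rho> \<in> borel_measurable \<tau>" "sqrt_deriv \<rho> \<tau> \<in> borel_measurable \<tau>"
    using assms sqrt_deriv_measurable_word_borel by (simp_all add: finite_borel_measurable)
  have "\<mu> = density (density \<tau> (\<lambda>x. ennreal ((cmod (sqrt_deriv \<rho> \<tau> x))\<^sup>2)))
      (\<lambda>x. ennreal ((cmod (sqrt_deriv \<mu> \<rho> x))\<^sup>2))"
    using assms by (simp add: density_sqrt_deriv)
  also have "\<dots> = density \<tau> (\<lambda>x. ennreal ((cmod (sqrt_deriv \<mu> \<rho> x) * cmod (sqrt_deriv \<rho> \<tau> x))\<^sup>2))"
    by (subst density_density_eq)
       (auto simp: power_mult_distrib mult.commute simp flip: ennreal_mult)
  finally have "AE x in \<tau>. sqrt_deriv \<mu> \<tau> x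
      = complex_of_real (cmod (sqrt_deriv \<mu> \<rho> x) * cmod (sqrt_deriv \<rho> \<tau> x))"
    using assms by (intro sqrt_deriv_eqI) auto
  then show ?thesis
    by eventually_elim (simp add: sqrt_deriv_def)
qed

lemma sqrt_deriv_refl:
  assumes "finite_borel N \<mu>"
  shows "AE x in \<mu>. sqrt_deriv \<mu> \<mu> x = 1"
  using sqrt_deriv_eqI[OF assms, of "\<lambda>_. 1"] by (simp add: density_1)

lemma integral_sqrt_deriv:
  fixes F :: "infword \<Rightarrow> complex"
  assumes "finite_borel N \<rho>" "finite_borel N \<mu>" "absolutely_continuous \<rho> \<mu>"
    and "F \<in> borel_measurable (word_borel N)"
  shows "(\<integral>x. F x \<partial>\<mu>) = (\<integral>x. F x * (sqrt_deriv \<mu> \<rho> x)\<^sup>2 \<partial>\<rho>)"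
proof -
  note [measurable] = sqrt_deriv_measurable[of \<mu> \<rho>]
  have [measurable]: "F \<in> borel_measurable \<rho>"
    using assms by (simp add: finite_borel_measurable)
  have "(\<integral>x. F x \<partial>\<mu>) = (\<integral>x. F x \<partial>density \<rho> (\<lambda>x. ennreal ((cmod (sqrt_deriv \<mu> \<rho> x))\<^sup>2)))"
    by (simp only: density_sqrt_deriv[OF assms(1-3)])
  also have "\<dots> = (\<integral>x. (cmod (sqrt_deriv \<mu> \<rho> x))\<^sup>2 *\<^sub>R F x \<partial>\<rho>)"
    by (intro integral_density) auto
  also have "\<dots> = (\<integral>x. F x * (sqrt_deriv \<mu> \<rho> x)\<^sup>2 \<partial>\<rho>)"
    by (intro Bochner_Integration.integral_cong)
       (auto simp: sqrt_deriv_def scaleR_conv_of_real mult.commute simp flip: of_real_power)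
  finally show ?thesis .
qed

section \<open>Square integrability and change of measure\<close>

lemma sq_integrable_iff_measurable:
  "finite_borel N \<mu> \<Longrightarrow> F \<in> sq_integrable \<mu> \<longleftrightarrow>
    F \<in> borel_measurable (word_borel N) \<and> integrable \<mu> (\<lambda>x. (cmod (F x))\<^sup>2)"
  by (simp add: sq_integrable_def finite_borel_measurable)

text \<open>Multiplying by the root turns the integrand of the squared norm over
  \<open>\<mu>\<close> into the one over \<open>\<rho>\<close>. This realises a sigma-function with
  measure \<open>\<mu>\<close> as an element of the L2 space of \<open>\<rho>\<close>.\<close>

lemma sq_integrable_sqrt_deriv_iff:
  assumes "finite_borel N \<rho>" "finite_borel N \<mu>" "absolutely_continuous \<rho> \<mu>"
    and "F \<in> borel_measurable (word_borel N)"
  shows "(\<lambda>x. F x * sqrt_deriv \<mu> \<rho> x) \<in> sq_integrable \<rho> \<longleftrightarrow> F \<in> sq_integrable \<mu>"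
proof -
  note [measurable] = sqrt_deriv_measurable[of \<mu> \<rho>]
  have [measurable]: "F \<in> borel_measurable \<rho>"
    using assms by (simp add: finite_borel_measurable)
  have "F \<in> borel_measurable \<mu>"
    using assms by (simp add: finite_borel_measurable)
  moreover have "integrable \<mu> (\<lambda>x. (cmod (F x))\<^sup>2)
      \<longleftrightarrow> integrable (density \<rho> (\<lambda>x. ennreal ((cmod (sqrt_deriv \<mu> \<rho> x))\<^sup>2))) (\<lambda>x. (cmod (F x))\<^sup>2)"
    by (simp only: density_sqrt_deriv[OF assms(1-3)])
  moreover have "\<dots> \<longleftrightarrow> integrable \<rho> (\<lambda>x. (cmod (F x * sqrt_deriv \<mu> \<rho> x))\<^sup>2)"
    by (subst integrable_density) (auto simp: norm_mult power_mult_distrib mult.commute)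
  ultimately show ?thesis
    by (simp add: sq_integrable_def)
qed

lemma sq_integrable_cong_AE:
  assumes "F \<in> borel_measurable M" "G \<in> borel_measurable M" "AE x in M. F x = G x"
  shows "F \<in> sq_integrable M \<longleftrightarrow> G \<in> sq_integrable M"
proof -
  have "integrable M (\<lambda>x. (cmod (F x))\<^sup>2) \<longleftrightarrow> integrable M (\<lambda>x. (cmod (G x))\<^sup>2)"
    using assms(1,2) by (intro integrable_cong_AE) (use assms(3) in \<open>auto elim: eventually_mono\<close>)
  then show ?thesis
    using assms by (simp add: sq_integrable_def)
qed

lemma sq_integrable_add:
  assumes "F \<in> sq_integrable M" "G \<in> sq_integrable M"
  shows "(\<lambda>x. F x + G x) \<in> sq_integrable M"
proof -
  have [measurable]: "F \<in> borel_measurable M" "G \<in> borel_measurable M"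
    using assms by (auto simp: sq_integrable_def)
  \<comment> \<open>Supplies an integrable majorant for the squared modulus of the sum; it rests on
    \<open>2ab \<le> a^2 + b^2\<close>.\<close>
  have bound: "(cmod (z + w))\<^sup>2 \<le> 2 * (cmod z)\<^sup>2 + 2 * (cmod w)\<^sup>2" for z w :: complex
  proof -
    have "(cmod (z + w))\<^sup>2 \<le> (cmod z + cmod w)\<^sup>2"
      by (intro power_mono norm_triangle_ineq) auto
    also have "\<dots> \<le> 2 * (cmod z)\<^sup>2 + 2 * (cmod w)\<^sup>2"
      using sum_squares_bound[of "cmod z" "cmod w"] by (simp add: power2_sum)
    finally show ?thesis .
  qed
  have "integrable M (\<lambda>x. (cmod (F x + G x))\<^sup>2)"
  proof (rule Bochner_Integration.integrable_bound)
    show "integrable M (\<lambda>x. 2 * (cmod (F x))\<^sup>2 + 2 * (cmod (G x))\<^sup>2)"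
      using assms by (simp add: sq_integrable_def)
    show "AE x in M. norm ((cmod (F x + G x))\<^sup>2) \<le> norm (2 * (cmod (F x))\<^sup>2 + 2 * (cmod (G x))\<^sup>2)"
      using bound by (intro AE_I2) simp
  qed measurable
  then show ?thesis
    by (simp add: sq_integrable_def)
qed

lemma sq_integrable_cmult:
  "F \<in> sq_integrable M \<Longrightarrow> (\<lambda>x. c * F x) \<in> sq_integrable M"
  by (auto simp: sq_integrable_def norm_mult power_mult_distrib)

section \<open>The equivalence relation behind sigma-functions\<close>

lemma dominating_iff:
  "\<rho> \<in> dominating N \<mu> \<nu> \<longleftrightarrow>
    finite_borel N \<rho> \<and> absolutely_continuous \<rho> \<mu> \<and> absolutely_continuous \<rho> \<nu>"
  by (simp add: dominating_def)

lemma sigma_pairs_iff: "(f, \<mu>) \<in> sigma_pairs N \<longleftrightarrow> finite_borel N \<mu> \<and> f \<in> sq_integrable \<mu>"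
  by (simp add: sigma_pairs_def)

text \<open>By the chain rule, passing from \<open>\<rho>\<close> to \<open>\<tau>\<close>
  multiplies both sides by \<open>sqrt_deriv \<rho> \<tau>\<close>. Where this factor vanishes the
  equation over \<open>\<tau>\<close> is trivial, and such points form a \<open>\<rho>\<close>-null
  set.\<close>

lemma sqrt_deriv_eq_transfer:
  assumes "finite_borel N \<tau>" "finite_borel N \<rho>" "finite_borel N \<mu>" "finite_borel N \<nu>"
    and "absolutely_continuous \<tau> \<rho>" "absolutely_continuous \<rho> \<mu>" "absolutely_continuous \<rho> \<nu>"
  shows "(AE x in \<rho>. f x * sqrt_deriv \<mu> \<rho> x = g x * sqrt_deriv \<nu> \<rho> x) \<longleftrightarrow>
         (AE x in \<tau>. f x * sqrt_deriv \<mu> \<tau> x = g x * sqrt_deriv \<nu> \<tau> x)"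
proof -
  have "AE x in \<tau>. (sqrt_deriv \<rho> \<tau> x \<noteq> 0 \<longrightarrow> f x * sqrt_deriv \<mu> \<rho> x = g x * sqrt_deriv \<nu> \<rho> x) \<longleftrightarrow>
      f x * sqrt_deriv \<mu> \<tau> x = g x * sqrt_deriv \<nu> \<tau> x"
    using sqrt_deriv_chain[OF assms(1,2,3,5,6)] sqrt_deriv_chain[OF assms(1,2,4,5,7)]
  proof eventually_elim
    case (elim x)
    show ?case
      unfolding elim by (metis mult.assoc mult_cancel_right mult_zero_right)
  qed
  then show ?thesis
    unfolding AE_iff_AE_sqrt_deriv[OF assms(1,2,5)]
    by (rule eventually_cong)
qed

text \<open>An equation known over one dominating measure is carried up to a measure
  \<open>\<tau>\<close> dominating both candidates and from there down to the other. So the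
  existential choice in \<open>sigma_rel\<close> may be replaced by any convenient dominating
  measure.\<close>

lemma sigma_rel_iff:
  assumes "\<rho> \<in> dominating N \<mu> \<nu>"
  shows "((f, \<mu>), (g, \<nu>)) \<in> sigma_rel N \<longleftrightarrow>
    (f, \<mu>) \<in> sigma_pairs N \<and> (g, \<nu>) \<in> sigma_pairs N \<and>
    (AE x in \<rho>. f x * sqrt_deriv \<mu> \<rho> x = g x * sqrt_deriv \<nu> \<rho> x)"
proof -
  have "AE x in \<rho>. f x * sqrt_deriv \<mu> \<rho> x = g x * sqrt_deriv \<nu> \<rho> x"
    if \<mu>: "finite_borel N \<mu>" and \<nu>: "finite_borel N \<nu>" and \<rho>': "\<rho>' \<in> dominating N \<mu> \<nu>"
      and AE: "AE x in \<rho>'. f x * sqrt_deriv \<mu> \<rho>' x = g x * sqrt_deriv \<nu> \<rho>' x" for \<rho>'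
  proof -
    have "finite_borel N \<rho>" "finite_borel N \<rho>'"
      using assms \<rho>' by (simp_all add: dominating_iff)
    then obtain \<tau> where \<tau>: "\<tau> \<in> dominating N \<rho> \<rho>'"
      using dominating_nonempty by blast
    have "AE x in \<tau>. f x * sqrt_deriv \<mu> \<tau> x = g x * sqrt_deriv \<nu> \<tau> x"
      using AE sqrt_deriv_eq_transfer[of N \<tau> \<rho>' \<mu> \<nu> f g] \<mu> \<nu> \<rho>' \<tau> by (simp add: dominating_iff)
    then show ?thesis
      using sqrt_deriv_eq_transfer[of N \<tau> \<rho> \<mu> \<nu> f g] \<mu> \<nu> assms \<tau> by (simp add: dominating_iff)
  qed
  then show ?thesis
    using assms by (auto simp: sigma_rel_def sigma_pairs_iff)
qed

lemma equiv_sigma_rel: "equiv (sigma_pairs N) (sigma_rel N)"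
proof (rule equivI)
  show "sigma_rel N \<subseteq> sigma_pairs N \<times> sigma_pairs N"
    by (auto simp: sigma_rel_def)
  show "refl_on (sigma_pairs N) (sigma_rel N)"
  proof (rule refl_onI)
    fix p assume "p \<in> sigma_pairs N"
    moreover obtain f \<mu> where "p = (f, \<mu>)" by (cases p)
    ultimately show "(p, p) \<in> sigma_rel N"
      using sigma_rel_iff[of \<mu> N \<mu> \<mu> f f]
      by (simp add: dominating_iff sigma_pairs_iff absolutely_continuous_refl)
  qed
  show "sym (sigma_rel N)"
    by (rule symI) (auto simp: sigma_rel_def dominating_def elim!: eventually_mono)
  show "trans (sigma_rel N)"
  proof (rule transI)
    fix p q r assume pq: "(p, q) \<in> sigma_rel N" and qr: "(q, r) \<in> sigma_rel N"
    obtain f \<mu> g \<nu> h \<kappa> where p: "p = (f, \<mu>)" and q: "q = (g, \<nu>)" and r: "r = (h, \<kappa>)"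
      by (metis surj_pair)
    have fin: "finite_borel N \<mu>" "finite_borel N \<nu>" "finite_borel N \<kappa>"
      using pq qr by (auto simp: p q r sigma_rel_def sigma_pairs_iff)
    then obtain \<rho> where \<rho>: "\<rho> \<in> dominating N \<mu> \<nu>"
      using dominating_nonempty by blast
    then have "finite_borel N \<rho>"
      by (simp add: dominating_iff)
    then obtain \<tau> where \<tau>: "\<tau> \<in> dominating N \<rho> \<kappa>"
      using fin(3) dominating_nonempty by blast
    \<comment> \<open>Transitivity needs one measure over which both given equations can be read;
      \<open>\<tau>\<close> dominates all three measures.\<close>
    have dom: "\<tau> \<in> dominating N \<mu> \<nu>" "\<tau> \<in> dominating N \<nu> \<kappa>" "\<tau> \<in> dominating N \<mu> \<kappa>"
      using \<rho> \<tau> absolutely_continuous_trans by (auto simp: dominating_iff)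
    show "(p, r) \<in> sigma_rel N"
      using pq qr unfolding p q r
      by (auto simp: sigma_rel_iff[OF dom(1)] sigma_rel_iff[OF dom(2)] sigma_rel_iff[OF dom(3)]
          elim: eventually_elim2)
  qed
qed

lemma sigma_fun_eq_iff:
  assumes "(f, \<mu>) \<in> sigma_pairs N" "(g, \<nu>) \<in> sigma_pairs N"
  shows "sigma_fun N f \<mu> = sigma_fun N g \<nu> \<longleftrightarrow> ((f, \<mu>), (g, \<nu>)) \<in> sigma_rel N"
  unfolding sigma_fun_def using eq_equiv_class_iff[OF equiv_sigma_rel assms] .

lemma mem_sigma_fun_self: "(f, \<mu>) \<in> sigma_pairs N \<Longrightarrow> (f, \<mu>) \<in> sigma_fun N f \<mu>"
  unfolding sigma_fun_def by (rule equiv_class_self[OF equiv_sigma_rel])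

lemma mem_sigma_fun_iff: "p \<in> sigma_fun N f \<mu> \<longleftrightarrow> ((f, \<mu>), p) \<in> sigma_rel N"
  by (simp add: sigma_fun_def)

section \<open>Classes of square-integrable functions and the operations of L2\<close>

lemma equiv_ae_rel: "equiv (sq_integrable M) (ae_rel M)"
proof (rule equivI)
  show "ae_rel M \<subseteq> sq_integrable M \<times> sq_integrable M"
    by (auto simp: ae_rel_def)
  show "refl_on (sq_integrable M) (ae_rel M)"
    by (rule refl_onI) (auto simp: ae_rel_def)
  show "sym (ae_rel M)"
    by (rule symI) (auto simp: ae_rel_def elim!: eventually_mono)
  show "trans (ae_rel M)"
    by (rule transI) (auto simp: ae_rel_def elim: eventually_elim2)
qed

lemma L2_class_eq_iff:
  assumes "f \<in> sq_integrable M" "g \<in> sq_integrable M"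
  shows "L2_class M f = L2_class M g \<longleftrightarrow> (AE x in M. f x = g x)"
  unfolding L2_class_def using eq_equiv_class_iff[OF equiv_ae_rel assms] assms
  by (simp add: ae_rel_def)

lemma mem_L2_class_iff:
  "g \<in> L2_class M f \<longleftrightarrow> f \<in> sq_integrable M \<and> g \<in> sq_integrable M \<and> (AE x in M. f x = g x)"
  by (simp add: L2_class_def ae_rel_def)

lemma mem_L2_class_self: "f \<in> sq_integrable M \<Longrightarrow> f \<in> L2_class M f"
  by (simp add: mem_L2_class_iff)

lemma vecs_L2E:
  assumes "a \<in> vecs (L2 M)"
  obtains f where "f \<in> sq_integrable M" "a = L2_class M f"
  using assms by (auto simp: L2_def L2_class_def elim: quotientE)

lemma borel_measurable_cnj [measurable]:
  "f \<in> borel_measurable M \<Longrightarrow> (\<lambda>x. cnj (f x)) \<in> borel_measurable M"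
  by (rule measurable_compose[OF _ borel_measurable_continuous_onI]) (auto intro: continuous_intros)

text \<open>All representatives yield the same class of sums, and the index sets contain
  \<open>f\<close> and \<open>g\<close>, so the nested union collapses to a single class. The other
  operations defined by unions are computed in the same way.\<close>

lemma L2_vadd:
  assumes "f \<in> sq_integrable M" "g \<in> sq_integrable M"
  shows "vadd (L2 M) (L2_class M f) (L2_class M g) = L2_class M (\<lambda>x. f x + g x)"
proof -
  have "L2_class M (\<lambda>x. h x + k x) = L2_class M (\<lambda>x. f x + g x)"
    if "h \<in> L2_class M f" "k \<in> L2_class M g" for h k
    using that by (subst L2_class_eq_iff) (auto simp: mem_L2_class_iff sq_integrable_add elim: eventually_elim2)
  then show ?thesis
    unfolding L2_def cip_space.simps
    by (intro UN_constant_eq[OF mem_L2_class_self[OF assms(1)]]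
        UN_constant_eq[OF mem_L2_class_self[OF assms(2)]] ballI)
qed

lemma L2_vscale:
  assumes "f \<in> sq_integrable M"
  shows "vscale (L2 M) c (L2_class M f) = L2_class M (\<lambda>x. c * f x)"
proof -
  have "L2_class M (\<lambda>x. c * h x) = L2_class M (\<lambda>x. c * f x)" if "h \<in> L2_class M f" for h
    using that
    by (subst L2_class_eq_iff)
       (auto simp: mem_L2_class_iff sq_integrable_cmult simp del: mult_cancel_left elim!: eventually_mono)
  then show ?thesis
    unfolding L2_def cip_space.simps
    by (intro UN_constant_eq[OF mem_L2_class_self[OF assms]] ballI)
qed

text \<open>The description by \<open>THE\<close> is meaningful because the integral does not change
  with the representatives; uniqueness comes from the classes being nonempty.\<close>

lemma L2_vinner:
  assumes "f \<in> sq_integrable M" "g \<in> sq_integrable M"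
  shows "vinner (L2 M) (L2_class M f) (L2_class M g) = (\<integral>x. cnj (f x) * g x \<partial>M)"
proof -
  have eq: "(\<integral>x. cnj (f x) * g x \<partial>M) = (\<integral>x. cnj (h x) * k x \<partial>M)"
    if "h \<in> L2_class M f" "k \<in> L2_class M g" for h k
  proof (rule integral_cong_AE)
    show "AE x in M. cnj (f x) * g x = cnj (h x) * k x"
      using that by (auto simp: mem_L2_class_iff elim: eventually_elim2)
    show "(\<lambda>x. cnj (f x) * g x) \<in> borel_measurable M" "(\<lambda>x. cnj (h x) * k x) \<in> borel_measurable M"
      using that by (auto simp: mem_L2_class_iff sq_integrable_def)
  qed
  show ?thesis
    unfolding L2_def cip_space.simps
  proof (rule the_equality)
    show "\<forall>h\<in>L2_class M f. \<forall>k\<in>L2_class M g. (\<integral>x. cnj (f x) * g x \<partial>M) = (\<integral>x. cnj (h x) * k x \<partial>M)"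
      using eq by blast
  qed (use assms mem_L2_class_self in blast)
qed

section \<open>Operations on sigma-functions that share one measure\<close>

lemma sigma_vadd:
  assumes f: "(f, \<mu>) \<in> sigma_pairs N" and g: "(g, \<mu>) \<in> sigma_pairs N"
  shows "vadd (sigma_space N) (sigma_fun N f \<mu>) (sigma_fun N g \<mu>) = sigma_fun N (\<lambda>x. f x + g x) \<mu>"
proof -
  have \<mu>: "finite_borel N \<mu>"
    using f by (simp add: sigma_pairs_iff)
  \<comment> \<open>Arbitrary representatives with an arbitrary dominating measure all produce one
    class, which is what collapses the three nested unions.\<close>
  have sum: "sigma_fun N (\<lambda>x. h x * sqrt_deriv \<nu> \<rho> x + k x * sqrt_deriv \<kappa> \<rho> x) \<rho>
      = sigma_fun N (\<lambda>x. f x + g x) \<mu>"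
    if h: "(h, \<nu>) \<in> sigma_fun N f \<mu>" and k: "(k, \<kappa>) \<in> sigma_fun N g \<mu>"
      and \<rho>: "\<rho> \<in> dominating N \<nu> \<kappa>" for h \<nu> k \<kappa> \<rho>
  proof -
    have \<nu>: "finite_borel N \<nu>" and \<kappa>: "finite_borel N \<kappa>"
      and hsq: "h \<in> sq_integrable \<nu>" and ksq: "k \<in> sq_integrable \<kappa>"
      using h k by (auto simp: mem_sigma_fun_iff sigma_rel_def sigma_pairs_iff)
    have \<rho>_fin: "finite_borel N \<rho>"
      using \<rho> by (simp add: dominating_iff)
    \<comment> \<open>Each summand is square integrable over \<open>\<rho>\<close> by change of
      measure; hence the sum with \<open>\<rho>\<close> is an admissible pair.\<close>
    have sq: "(\<lambda>x. h x * sqrt_deriv \<nu> \<rho> x + k x * sqrt_deriv \<kappa> \<rho> x) \<in> sq_integrable \<rho>"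
      using hsq ksq \<rho> \<nu> \<kappa>
      by (intro sq_integrable_add)
         (simp_all add: dominating_iff sq_integrable_sqrt_deriv_iff[of N] sq_integrable_iff_measurable)
    \<comment> \<open>Dominating \<open>\<rho>\<close>, the measure \<open>\<tau>\<close> also
      dominates \<open>\<nu>\<close> and \<open>\<kappa>\<close>, so \<open>h\<close> and
      \<open>k\<close> can be compared with \<open>f\<close> and \<open>g\<close> over it. The chain
      rule then accounts for the factor \<open>sqrt_deriv \<rho> \<tau>\<close>.\<close>
    obtain \<tau> where \<tau>: "\<tau> \<in> dominating N \<rho> \<mu>"
      using \<rho>_fin \<mu> dominating_nonempty by blast
    have dom: "\<tau> \<in> dominating N \<mu> \<nu>" "\<tau> \<in> dominating N \<mu> \<kappa>"
      using \<rho> \<tau> absolutely_continuous_trans by (auto simp: dominating_iff)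
    have "AE x in \<tau>. f x * sqrt_deriv \<mu> \<tau> x = h x * sqrt_deriv \<nu> \<tau> x"
      using h by (simp add: mem_sigma_fun_iff sigma_rel_iff[OF dom(1)])
    moreover have "AE x in \<tau>. g x * sqrt_deriv \<mu> \<tau> x = k x * sqrt_deriv \<kappa> \<tau> x"
      using k by (simp add: mem_sigma_fun_iff sigma_rel_iff[OF dom(2)])
    moreover have "AE x in \<tau>. sqrt_deriv \<nu> \<tau> x = sqrt_deriv \<nu> \<rho> x * sqrt_deriv \<rho> \<tau> x"
      using \<tau> \<rho> \<nu> by (intro sqrt_deriv_chain) (auto simp: dominating_iff)
    moreover have "AE x in \<tau>. sqrt_deriv \<kappa> \<tau> x = sqrt_deriv \<kappa> \<rho> x * sqrt_deriv \<rho> \<tau> x"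
      using \<tau> \<rho> \<kappa> by (intro sqrt_deriv_chain) (auto simp: dominating_iff)
    ultimately have "AE x in \<tau>. (h x * sqrt_deriv \<nu> \<rho> x + k x * sqrt_deriv \<kappa> \<rho> x) * sqrt_deriv \<rho> \<tau> x
        = (f x + g x) * sqrt_deriv \<mu> \<tau> x"
      by eventually_elim (simp add: algebra_simps)
    then show ?thesis
      using f g sq \<rho>_fin
      by (subst sigma_fun_eq_iff) (auto simp: sigma_rel_iff[OF \<tau>] sigma_pairs_iff sq_integrable_add)
  qed
  show ?thesis
    unfolding sigma_space_def cip_space.simps
  proof (intro UN_constant_eq[OF mem_sigma_fun_self[OF f]] ballI, clarify)
    fix h \<nu> assume h: "(h, \<nu>) \<in> sigma_fun N f \<mu>"
    show "(\<Union>(k, \<kappa>)\<in>sigma_fun N g \<mu>. \<Union>\<rho>\<in>dominating N \<nu> \<kappa>.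
        sigma_fun N (\<lambda>x. h x * sqrt_deriv \<nu> \<rho> x + k x * sqrt_deriv \<kappa> \<rho> x) \<rho>)
      = sigma_fun N (\<lambda>x. f x + g x) \<mu>"
    proof (intro UN_constant_eq[OF mem_sigma_fun_self[OF g]] ballI, clarify)
      fix k \<kappa> assume k: "(k, \<kappa>) \<in> sigma_fun N g \<mu>"
      \<comment> \<open>The innermost union must have a nonempty index set; otherwise it would be
        the empty set instead of a class.\<close>
      obtain \<rho> where "\<rho> \<in> dominating N \<nu> \<kappa>"
        using h k dominating_nonempty[of N \<nu> \<kappa>]
        by (auto simp: mem_sigma_fun_iff sigma_rel_def sigma_pairs_iff)
      then show "(\<Union>\<rho>\<in>dominating N \<nu> \<kappa>.
          sigma_fun N (\<lambda>x. h x * sqrt_deriv \<nu> \<rho> x + k x * sqrt_deriv \<kappa> \<rho> x) \<rho>)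
        = sigma_fun N (\<lambda>x. f x + g x) \<mu>"
        by (rule UN_constant_eq) (use sum[OF h k] in blast)
    qed
  qed
qed

text \<open>A dominating measure witnessing that \<open>h\<close> and \<open>f\<close> represent the
  same class remains a witness after both functions are multiplied by \<open>c\<close>.\<close>

lemma sigma_vscale:
  assumes f: "(f, \<mu>) \<in> sigma_pairs N"
  shows "vscale (sigma_space N) c (sigma_fun N f \<mu>) = sigma_fun N (\<lambda>x. c * f x) \<mu>"
  unfolding sigma_space_def cip_space.simps
proof (intro UN_constant_eq[OF mem_sigma_fun_self[OF f]] ballI, clarify)
  fix h \<nu> assume "(h, \<nu>) \<in> sigma_fun N f \<mu>"
  then have "((\<lambda>x. c * f x, \<mu>), (\<lambda>x. c * h x, \<nu>)) \<in> sigma_rel N"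
    by (auto simp: mem_sigma_fun_iff sigma_rel_def sigma_pairs_iff sq_integrable_cmult mult.assoc
        elim!: bexI[rotated] eventually_mono)
  then show "sigma_fun N (\<lambda>x. c * h x) \<nu> = sigma_fun N (\<lambda>x. c * f x) \<mu>"
    unfolding sigma_fun_def by (rule equiv_class_eq[OF equiv_sigma_rel, symmetric])
qed

text \<open>Both integrals are moved to a measure \<open>\<tau>\<close> dominating
  \<open>\<rho>\<close> and \<open>\<mu>\<close>, where the integrands agree almost everywhere by
  the chain rule. Hence every choice of representatives and of \<open>\<rho>\<close> gives the same
  number.\<close>

lemma sigma_vinner:
  assumes f: "(f, \<mu>) \<in> sigma_pairs N" and g: "(g, \<mu>) \<in> sigma_pairs N"
  shows "vinner (sigma_space N) (sigma_fun N f \<mu>) (sigma_fun N g \<mu>) = (\<integral>x. cnj (f x) * g x \<partial>\<mu>)"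
proof -
  have \<mu>: "finite_borel N \<mu>"
    using f by (simp add: sigma_pairs_iff)
  have [measurable]: "f \<in> borel_measurable (word_borel N)" "g \<in> borel_measurable (word_borel N)"
    using f g by (auto simp: sigma_pairs_iff sq_integrable_iff_measurable)
  have eq: "(\<integral>x. cnj (f x) * g x \<partial>\<mu>)
      = (\<integral>x. cnj (h x) * k x * sqrt_deriv \<nu> \<rho> x * sqrt_deriv \<kappa> \<rho> x \<partial>\<rho>)"
    if h: "(h, \<nu>) \<in> sigma_fun N f \<mu>" and k: "(k, \<kappa>) \<in> sigma_fun N g \<mu>"
      and \<rho>: "\<rho> \<in> dominating N \<nu> \<kappa>" for h \<nu> k \<kappa> \<rho>
  proof -
    have \<nu>: "finite_borel N \<nu>" and \<kappa>: "finite_borel N \<kappa>"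
      and [measurable]: "h \<in> borel_measurable (word_borel N)" "k \<in> borel_measurable (word_borel N)"
      using h k by (auto simp: mem_sigma_fun_iff sigma_rel_def sigma_pairs_iff sq_integrable_iff_measurable)
    have \<rho>_fin: "finite_borel N \<rho>"
      using \<rho> by (simp add: dominating_iff)
    obtain \<tau> where \<tau>: "\<tau> \<in> dominating N \<rho> \<mu>"
      using \<rho>_fin \<mu> dominating_nonempty by blast
    have \<tau>_fin: "finite_borel N \<tau>"
      using \<tau> by (simp add: dominating_iff)
    note [measurable] = sqrt_deriv_measurable_word_borel[OF \<rho>_fin] sqrt_deriv_measurable_word_borel[OF \<tau>_fin]
    have dom: "\<tau> \<in> dominating N \<mu> \<nu>" "\<tau> \<in> dominating N \<mu> \<kappa>"
      using \<rho> \<tau> absolutely_continuous_trans by (auto simp: dominating_iff)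
    have "AE x in \<tau>. f x * sqrt_deriv \<mu> \<tau> x = h x * sqrt_deriv \<nu> \<tau> x"
      using h by (simp add: mem_sigma_fun_iff sigma_rel_iff[OF dom(1)])
    moreover have "AE x in \<tau>. g x * sqrt_deriv \<mu> \<tau> x = k x * sqrt_deriv \<kappa> \<tau> x"
      using k by (simp add: mem_sigma_fun_iff sigma_rel_iff[OF dom(2)])
    moreover have "AE x in \<tau>. sqrt_deriv \<nu> \<tau> x = sqrt_deriv \<nu> \<rho> x * sqrt_deriv \<rho> \<tau> x"
      using \<tau> \<rho> \<nu> by (intro sqrt_deriv_chain) (auto simp: dominating_iff)
    moreover have "AE x in \<tau>. sqrt_deriv \<kappa> \<tau> x = sqrt_deriv \<kappa> \<rho> x * sqrt_deriv \<rho> \<tau> x"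
      using \<tau> \<rho> \<kappa> by (intro sqrt_deriv_chain) (auto simp: dominating_iff)
    ultimately have AE: "AE x in \<tau>. cnj (f x) * g x * (sqrt_deriv \<mu> \<tau> x)\<^sup>2
        = cnj (h x) * k x * sqrt_deriv \<nu> \<rho> x * sqrt_deriv \<kappa> \<rho> x * (sqrt_deriv \<rho> \<tau> x)\<^sup>2"
    proof eventually_elim
      case (elim x)
      \<comment> \<open>The root is real, so one factor can be moved under the conjugation; each
        function is then paired with its own root and can be replaced.\<close>
      have "cnj (f x) * g x * (sqrt_deriv \<mu> \<tau> x)\<^sup>2
          = cnj (f x * sqrt_deriv \<mu> \<tau> x) * (g x * sqrt_deriv \<mu> \<tau> x)"
        by (simp add: power2_eq_square)
      also have "\<dots> = cnj (h x) * k x * sqrt_deriv \<nu> \<rho> x * sqrt_deriv \<kappa> \<rho> x * (sqrt_deriv \<rho> \<tau> x)\<^sup>2"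
        unfolding elim by (simp add: power2_eq_square)
      finally show ?case .
    qed
    have "(\<integral>x. cnj (f x) * g x \<partial>\<mu>) = (\<integral>x. cnj (f x) * g x * (sqrt_deriv \<mu> \<tau> x)\<^sup>2 \<partial>\<tau>)"
      using \<tau> \<mu> by (intro integral_sqrt_deriv[of N]) (auto simp: dominating_iff)
    also have "\<dots> = (\<integral>x. cnj (h x) * k x * sqrt_deriv \<nu> \<rho> x * sqrt_deriv \<kappa> \<rho> x * (sqrt_deriv \<rho> \<tau> x)\<^sup>2 \<partial>\<tau>)"
      by (intro integral_cong_AE AE) (simp_all add: finite_borel_measurable[OF \<tau>_fin])
    also have "\<dots> = (\<integral>x. cnj (h x) * k x * sqrt_deriv \<nu> \<rho> x * sqrt_deriv \<kappa> \<rho> x \<partial>\<rho>)"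
      using \<tau> \<rho>_fin by (intro integral_sqrt_deriv[of N, symmetric]) (auto simp: dominating_iff)
    finally show ?thesis .
  qed
  show ?thesis
    unfolding sigma_space_def cip_space.simps
  proof (rule the_equality)
    show "\<forall>(h, \<nu>)\<in>sigma_fun N f \<mu>. \<forall>(k, \<kappa>)\<in>sigma_fun N g \<mu>. \<forall>\<rho>\<in>dominating N \<nu> \<kappa>.
        (\<integral>x. cnj (f x) * g x \<partial>\<mu>)
          = (\<integral>x. cnj (h x) * k x * sqrt_deriv \<nu> \<rho> x * sqrt_deriv \<kappa> \<rho> x \<partial>\<rho>)"
      using eq by blast
  next
    fix z
    assume z: "\<forall>(h, \<nu>)\<in>sigma_fun N f \<mu>. \<forall>(k, \<kappa>)\<in>sigma_fun N g \<mu>. \<forall>\<rho>\<in>dominating N \<nu> \<kappa>.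
        z = (\<integral>x. cnj (h x) * k x * sqrt_deriv \<nu> \<rho> x * sqrt_deriv \<kappa> \<rho> x \<partial>\<rho>)"
    \<comment> \<open>Uniqueness of the value follows by testing with \<open>f\<close>,
      \<open>g\<close> and \<open>\<mu>\<close> itself as dominating measure.\<close>
    have \<mu>_dom: "\<mu> \<in> dominating N \<mu> \<mu>"
      using \<mu> by (simp add: dominating_iff absolutely_continuous_refl)
    then show "z = (\<integral>x. cnj (f x) * g x \<partial>\<mu>)"
      using z eq mem_sigma_fun_self[OF f] mem_sigma_fun_self[OF g] by fastforce
  qed
qed

section \<open>The map W as an isometric embedding\<close>

lemma W_map_L2_class:
  assumes "finite_borel N \<mu>" "f \<in> sq_integrable \<mu>"
  shows "W_map N \<mu> (L2_class \<mu> f) = sigma_fun N f \<mu>"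
  unfolding W_map_def
proof (intro UN_constant_eq[OF mem_L2_class_self[OF assms(2)]] ballI)
  fix g assume g: "g \<in> L2_class \<mu> f"
  \<comment> \<open>With \<open>\<mu>\<close> itself as dominating measure both sides carry the same
    root, so almost everywhere equality of the functions suffices.\<close>
  have dom: "\<mu> \<in> dominating N \<mu> \<mu>"
    using assms by (simp add: dominating_iff absolutely_continuous_refl)
  from g assms show "sigma_fun N g \<mu> = sigma_fun N f \<mu>"
    by (subst sigma_fun_eq_iff)
       (auto simp: mem_L2_class_iff sigma_pairs_iff sigma_rel_iff[OF dom] elim!: eventually_mono)
qed

text \<open>Over \<open>\<mu>\<close> itself the root is 1 almost everywhere and can be cancelled.
  This gives injectivity of W.\<close>

lemma sigma_fun_same_measure_eqD:
  assumes "(f, \<mu>) \<in> sigma_pairs N" "(g, \<mu>) \<in> sigma_pairs N" "sigma_fun N f \<mu> = sigma_fun N g \<mu>"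
  shows "AE x in \<mu>. f x = g x"
proof -
  have \<mu>: "finite_borel N \<mu>"
    using assms by (simp add: sigma_pairs_iff)
  then have dom: "\<mu> \<in> dominating N \<mu> \<mu>"
    by (simp add: dominating_iff absolutely_continuous_refl)
  have "AE x in \<mu>. f x * sqrt_deriv \<mu> \<mu> x = g x * sqrt_deriv \<mu> \<mu> x"
    using assms(3) by (simp add: sigma_fun_eq_iff[OF assms(1,2)] sigma_rel_iff[OF dom])
  with sqrt_deriv_refl[OF \<mu>] show ?thesis
    by eventually_elim simp
qed

text \<open>On representatives W keeps the function and attaches \<open>\<mu>\<close>, and the
  operations on both sides have been computed by the same formulas over
  \<open>\<mu>\<close>.\<close>

lemma isometric_embedding_W_map:
  assumes \<mu>: "finite_borel N \<mu>"
  shows "isometric_embedding (L2 \<mu>) (sigma_space N) (W_map N \<mu>)"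
  unfolding isometric_embedding_def
proof (intro conjI ballI allI inj_onI)
  note W = W_map_L2_class[OF \<mu>]
  note simps = W L2_vadd L2_vscale L2_vinner sigma_vadd sigma_vscale sigma_vinner
    sigma_pairs_iff \<mu> sq_integrable_add sq_integrable_cmult
  fix a assume "a \<in> vecs (L2 \<mu>)"
  then obtain f where f: "f \<in> sq_integrable \<mu>" and a: "a = L2_class \<mu> f"
    by (rule vecs_L2E)
  show "W_map N \<mu> a \<in> vecs (sigma_space N)"
    using f \<mu> by (simp add: a W sigma_space_def sigma_fun_def quotientI sigma_pairs_iff)
  show "W_map N \<mu> (vscale (L2 \<mu>) c a) = vscale (sigma_space N) c (W_map N \<mu> a)" for c
    using f by (simp add: a simps)
  fix b assume "b \<in> vecs (L2 \<mu>)"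
  then obtain g where g: "g \<in> sq_integrable \<mu>" and b: "b = L2_class \<mu> g"
    by (rule vecs_L2E)
  show "W_map N \<mu> (vadd (L2 \<mu>) a b) = vadd (sigma_space N) (W_map N \<mu> a) (W_map N \<mu> b)"
    using f g by (simp add: a b simps)
  show "vinner (sigma_space N) (W_map N \<mu> a) (W_map N \<mu> b) = vinner (L2 \<mu>) a b"
    using f g by (simp add: a b simps)
  assume "W_map N \<mu> a = W_map N \<mu> b"
  then show "a = b"
    using f g sigma_fun_same_measure_eqD[of f \<mu> N g]
    by (simp add: a b W L2_class_eq_iff sigma_pairs_iff \<mu>)
qed

section \<open>Shift, prefixing and push-forward measures\<close>

lemma shift_prepend [simp]: "shift (prepend i w) = w"
  by (simp add: shift_def prepend_def)

lemma measurable_shift [measurable]: "shift \<in> word_borel N \<rightarrow>\<^sub>M word_borel N"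
proof -
  have "continuous_on UNIV shift"
    unfolding shift_def
    by (intro continuous_on_coordinatewise_then_product continuous_on_product_coordinates)
  then show ?thesis
    unfolding word_borel_def
    by (intro measurable_restrict_space3 borel_measurable_continuous_onI) (auto simp: words_def shift_def)
qed

text \<open>Continuity is checked coordinatewise: coordinate 0 is constant and the others are
  projections. The bound on \<open>i\<close> keeps the result inside \<open>words N\<close>.\<close>

lemma measurable_prepend:
  assumes "i < N"
  shows "prepend i \<in> word_borel N \<rightarrow>\<^sub>M word_borel N"
proof -
  have "continuous_on UNIV (prepend i)"
    unfolding prepend_def
  proof (rule continuous_on_coordinatewise_then_product)
    show "continuous_on UNIV (\<lambda>w. case_nat i w k)" for k
      by (cases k) (auto intro: continuous_on_product_coordinates)
  qed
  then show ?thesis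
    unfolding word_borel_def using assms
    by (intro measurable_restrict_space3 borel_measurable_continuous_onI)
       (auto simp: words_def prepend_def split: nat.split)
qed

lemma measurable_prepend':
  assumes "i < N" "finite_borel N \<mu>"
  shows "prepend i \<in> \<mu> \<rightarrow>\<^sub>M word_borel N"
  using measurable_prepend assms by (simp add: finite_borel_measurable)

lemma finite_borel_push:
  assumes "i < N" "finite_borel N \<mu>"
  shows "finite_borel N (push N i \<mu>)"
  using assms finite_measure.finite_measure_distr[OF finite_borel_imp_finite measurable_prepend']
  by (simp add: finite_borel_def push_def)

text \<open>The shift undoes \<open>prepend i\<close>, so pushing \<open>push N i \<mu>\<close>
  forward along the shift gives \<open>\<mu>\<close> back.\<close>

lemma AE_pushI:
  assumes "i < N" "finite_borel N \<mu>" "AE x in \<mu>. P x"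
  shows "AE x in push N i \<mu>. P (shift x)"
proof (rule AE_distrD[where M' = \<mu>])
  have "distr (push N i \<mu>) \<mu> shift = distr \<mu> \<mu> (shift \<circ> prepend i)"
    unfolding push_def
    using assms measurable_shift
    by (intro distr_distr measurable_prepend') (simp_all add: measurable_cong_sets[OF refl finite_borel_sets])
  also have "\<dots> = \<mu>"
    by (simp add: comp_def distr_id)
  finally show "AE x in distr (push N i \<mu>) \<mu> shift. P x"
    using assms(3) by (simp only:)
  show "shift \<in> push N i \<mu> \<rightarrow>\<^sub>M \<mu>"
    using assms measurable_shift
    by (simp add: push_def measurable_cong_sets[OF refl finite_borel_sets])
qed

text \<open>A density over a push-forward is the push-forward of the density composed with
  \<open>prepend i\<close>, and that composition cancels the shift. Thus the derivative of the
  push-forwards is the original derivative composed with the shift.\<close>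

lemma density_push:
  assumes "i < N" "finite_borel N \<rho>" "finite_borel N \<mu>" "absolutely_continuous \<rho> \<mu>"
  shows "density (push N i \<rho>) (\<lambda>x. ennreal ((cmod (sqrt_deriv \<mu> \<rho> (shift x)))\<^sup>2)) = push N i \<mu>"
proof -
  note [measurable] = sqrt_deriv_measurable_word_borel[OF assms(2)]
  have "density (push N i \<rho>) (\<lambda>x. ennreal ((cmod (sqrt_deriv \<mu> \<rho> (shift x)))\<^sup>2))
      = distr (density \<rho> (\<lambda>x. ennreal ((cmod (sqrt_deriv \<mu> \<rho> x))\<^sup>2))) (word_borel N) (prepend i)"
    unfolding push_def using measurable_prepend'[OF assms(1,2)]
    by (subst density_distr) auto
  then show ?thesis
    by (simp add: density_sqrt_deriv[OF assms(2-4)] push_def)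
qed

lemma absolutely_continuous_push:
  assumes "i < N" "finite_borel N \<rho>" "finite_borel N \<mu>" "absolutely_continuous \<rho> \<mu>"
  shows "absolutely_continuous (push N i \<rho>) (push N i \<mu>)"
proof -
  note [measurable] = sqrt_deriv_measurable_word_borel[OF assms(2)]
  show ?thesis
    by (subst density_push[OF assms, symmetric], rule absolutely_continuousI_density)
       (simp add: push_def)
qed

text \<open>Uniqueness of the derivative applied to \<open>density_push\<close>. This lets an
  equation between sigma-functions be composed with the shift.\<close>

lemma sqrt_deriv_push:
  assumes "i < N" "finite_borel N \<rho>" "finite_borel N \<mu>" "absolutely_continuous \<rho> \<mu>"
  shows "AE x in push N i \<rho>. sqrt_deriv (push N i \<mu>) (push N i \<rho>) x = sqrt_deriv \<mu> \<rho> (shift x)"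
proof -
  note [measurable] = sqrt_deriv_measurable_word_borel[OF assms(2)]
  have "AE x in push N i \<rho>. sqrt_deriv (push N i \<mu>) (push N i \<rho>) x
      = complex_of_real (cmod (sqrt_deriv \<mu> \<rho> (shift x)))"
    using density_push[OF assms] finite_borel_push assms
    by (intro sqrt_deriv_eqI[of N]) (auto simp: push_def)
  then show ?thesis
    by eventually_elim (simp add: sqrt_deriv_def)
qed

section \<open>The universal operators and the intertwining relation\<close>

lemma sigma_pairs_push:
  assumes "i < N" "(h, \<nu>) \<in> sigma_pairs N"
  shows "(h \<circ> shift, push N i \<nu>) \<in> sigma_pairs N"
proof -
  have \<nu>: "finite_borel N \<nu>" and int: "integrable \<nu> (\<lambda>x. (cmod (h x))\<^sup>2)"
    and [measurable]: "h \<in> borel_measurable (word_borel N)"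
    using assms by (auto simp: sigma_pairs_iff sq_integrable_iff_measurable)
  have "integrable (push N i \<nu>) (\<lambda>x. (cmod (h (shift x)))\<^sup>2)"
    unfolding push_def using int measurable_prepend'[OF assms(1) \<nu>]
    by (subst integrable_distr_eq) auto
  then show ?thesis
    using finite_borel_push[OF assms(1) \<nu>]
    by (auto simp: sigma_pairs_iff sq_integrable_iff_measurable comp_def)
qed

text \<open>Independence of the representative: if \<open>\<rho>\<close> dominates
  \<open>\<mu>\<close> and \<open>\<nu>\<close>, then \<open>push N i \<rho>\<close> dominates their
  push-forwards, and the equation over \<open>\<rho>\<close> composed with the shift is the required
  one.\<close>

lemma universal_op_sigma_fun:
  assumes i: "i < N" and g: "(g, \<mu>) \<in> sigma_pairs N"
  shows "universal_op N i (sigma_fun N g \<mu>) = sigma_fun N (g \<circ> shift) (push N i \<mu>)"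
  unfolding universal_op_def
proof (intro UN_constant_eq[OF mem_sigma_fun_self[OF g]] ballI, clarify)
  fix h \<nu> assume h: "(h, \<nu>) \<in> sigma_fun N g \<mu>"
  have \<mu>: "finite_borel N \<mu>" and \<nu>: "finite_borel N \<nu>" and h_pair: "(h, \<nu>) \<in> sigma_pairs N"
    using g h by (auto simp: mem_sigma_fun_iff sigma_rel_def sigma_pairs_iff)
  obtain \<rho> where \<rho>: "\<rho> \<in> dominating N \<mu> \<nu>"
    using \<mu> \<nu> dominating_nonempty by blast
  then have \<rho>_fin: "finite_borel N \<rho>" and ac: "absolutely_continuous \<rho> \<mu>" "absolutely_continuous \<rho> \<nu>"
    by (auto simp: dominating_iff)
  have dom: "push N i \<rho> \<in> dominating N (push N i \<nu>) (push N i \<mu>)"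
    using finite_borel_push absolutely_continuous_push i \<rho>_fin \<mu> \<nu> ac by (simp add: dominating_iff)
  have "AE x in \<rho>. g x * sqrt_deriv \<mu> \<rho> x = h x * sqrt_deriv \<nu> \<rho> x"
    using h by (simp add: mem_sigma_fun_iff sigma_rel_iff[OF \<rho>])
  from AE_pushI[OF i \<rho>_fin this] sqrt_deriv_push[OF i \<rho>_fin \<mu> ac(1)] sqrt_deriv_push[OF i \<rho>_fin \<nu> ac(2)]
  have "AE x in push N i \<rho>. (h \<circ> shift) x * sqrt_deriv (push N i \<nu>) (push N i \<rho>) x
      = (g \<circ> shift) x * sqrt_deriv (push N i \<mu>) (push N i \<rho>) x"
    by eventually_elim simp
  then show "sigma_fun N (h \<circ> shift) (push N i \<nu>) = sigma_fun N (g \<circ> shift) (push N i \<mu>)"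
    using sigma_pairs_push[OF i g] sigma_pairs_push[OF i h_pair]
    by (simp add: sigma_fun_eq_iff sigma_rel_iff[OF dom])
qed

text \<open>The hypothesis \<open>f_eq\<close> is the form in which nonnegativity enters:
  \<open>f i\<close> is the root of the derivative itself, without a phase factor.\<close>

lemma W_map_monic_op:
  assumes \<mu>: "finite_borel N \<mu>" and i: "i < N"
    and ac: "absolutely_continuous \<mu> (push N i \<mu>)"
    and f: "f i \<in> borel_measurable \<mu>"
    and f_eq: "AE x in \<mu>. sqrt_deriv (push N i \<mu>) \<mu> x = f i x"
    and a: "a \<in> vecs (L2 \<mu>)"
  shows "W_map N \<mu> (monic_op \<mu> f i a) = universal_op N i (W_map N \<mu> a)"
proof -
  let ?\<nu> = "push N i \<mu>"
  obtain g where g: "g \<in> sq_integrable \<mu>" and a: "a = L2_class \<mu> g"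
    using a by (rule vecs_L2E)
  have \<nu>: "finite_borel N ?\<nu>"
    using i \<mu> by (rule finite_borel_push)
  \<comment> \<open>Almost everywhere \<open>f i\<close> is the root, so this is
    \<open>h \<circ> shift\<close>, square integrable over the push-forward, moved to
    \<open>\<mu>\<close> by change of measure.\<close>
  have sq: "(\<lambda>x. f i x * h (shift x)) \<in> sq_integrable \<mu>" if h: "h \<in> sq_integrable \<mu>" for h
  proof -
    have hs: "h \<circ> shift \<in> sq_integrable ?\<nu>"
      using sigma_pairs_push[OF i, of h \<mu>] h \<mu> by (simp add: sigma_pairs_iff)
    then have "(\<lambda>x. (h \<circ> shift) x * sqrt_deriv ?\<nu> \<mu> x) \<in> sq_integrable \<mu>"
      using sq_integrable_sqrt_deriv_iff[OF \<mu> \<nu> ac, of "h \<circ> shift"] sq_integrable_iff_measurable[OF \<nu>]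
      by blast
    moreover have "(\<lambda>x. f i x * h (shift x)) \<in> borel_measurable \<mu>"
    proof -
      have [measurable]: "h \<in> borel_measurable (word_borel N)" "f i \<in> borel_measurable (word_borel N)"
        using h f \<mu> by (auto simp: sq_integrable_iff_measurable finite_borel_measurable)
      show ?thesis
        unfolding finite_borel_measurable[OF \<mu>] by measurable
    qed
    ultimately show ?thesis
      using f_eq
      by (subst sq_integrable_cong_AE[of _ _ "\<lambda>x. (h \<circ> shift) x * sqrt_deriv ?\<nu> \<mu> x"])
         (auto simp: sq_integrable_def elim: eventually_mono)
  qed
  have "monic_op \<mu> f i a = L2_class \<mu> (\<lambda>x. f i x * g (shift x))"
    unfolding monic_op_def a
  proof (intro UN_constant_eq[OF mem_L2_class_self[OF g]] ballI)
    fix h assume h: "h \<in> L2_class \<mu> g"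
    then have "AE x in \<mu>. g x = h x"
      by (simp add: mem_L2_class_iff)
    then have "AE x in ?\<nu>. g (shift x) = h (shift x)"
      by (rule AE_pushI[OF i \<mu>])
    \<comment> \<open>Representatives composed with the shift need only agree where the root is
      nonzero; elsewhere \<open>f i\<close> vanishes too, so the products still agree.\<close>
    then have "AE x in \<mu>. sqrt_deriv ?\<nu> \<mu> x \<noteq> 0 \<longrightarrow> g (shift x) = h (shift x)"
      by (simp add: AE_iff_AE_sqrt_deriv[OF \<mu> \<nu> ac])
    with f_eq have "AE x in \<mu>. f i x * h (shift x) = f i x * g (shift x)"
      by eventually_elim auto
    then show "L2_class \<mu> (\<lambda>x. f i x * h (shift x)) = L2_class \<mu> (\<lambda>x. f i x * g (shift x))"
      using h by (subst L2_class_eq_iff) (auto simp: mem_L2_class_iff sq)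
  qed
  then have "W_map N \<mu> (monic_op \<mu> f i a) = sigma_fun N (\<lambda>x. f i x * g (shift x)) \<mu>"
    using W_map_L2_class[OF \<mu> sq[OF g]] by simp
  also have "\<dots> = sigma_fun N (g \<circ> shift) ?\<nu>"
  proof -
    \<comment> \<open>Both pairs are compared over \<open>\<mu>\<close>: one root is 1 and the other
      is \<open>f i\<close>.\<close>
    have dom: "\<mu> \<in> dominating N \<mu> ?\<nu>"
      using \<mu> ac by (simp add: dominating_iff absolutely_continuous_refl)
    have "AE x in \<mu>. f i x * g (shift x) * sqrt_deriv \<mu> \<mu> x = (g \<circ> shift) x * sqrt_deriv ?\<nu> \<mu> x"
      using sqrt_deriv_refl[OF \<mu>] f_eq by eventually_elim simp
    then show ?thesis
      using sq[OF g] \<mu> sigma_pairs_push[OF i, of g \<mu>] g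
      by (simp add: sigma_fun_eq_iff sigma_rel_iff[OF dom] sigma_pairs_iff)
  qed
  also have "\<dots> = universal_op N i (W_map N \<mu> a)"
    using universal_op_sigma_fun[OF i, of g \<mu>] g \<mu> by (simp add: a W_map_L2_class sigma_pairs_iff)
  finally show ?thesis .
qed

theorem proposition4p8:
  fixes N :: nat
    and \<mu> :: "infword measure"
    and f :: "nat \<Rightarrow> infword \<Rightarrow> complex"
  assumes "N \<ge> 2"
    and "nonneg_monic_system N \<mu> f"
  shows "isometric_embedding (L2 \<mu>) (sigma_space N) (W_map N \<mu>) \<and>
         (\<forall>i<N. \<forall>a \<in> vecs (L2 \<mu>).
            W_map N \<mu> (monic_op \<mu> f i a) = universal_op N i (W_map N \<mu> a))"
proof (intro conjI allI impI ballI)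
  have \<mu>: "finite_borel N \<mu>"
    using assms(2) by (simp add: nonneg_monic_system_def monic_system_def)
  then show "isometric_embedding (L2 \<mu>) (sigma_space N) (W_map N \<mu>)"
    by (rule isometric_embedding_W_map)
  fix i a assume i: "i < N" and a: "a \<in> vecs (L2 \<mu>)"
  have ac: "absolutely_continuous \<mu> (push N i \<mu>)" and f: "f i \<in> borel_measurable \<mu>"
    and RN: "AE x in \<mu>. RN_deriv \<mu> (push N i \<mu>) x = ennreal ((cmod (f i x))\<^sup>2)"
    and nonneg: "AE x in \<mu>. f i x \<in> \<real>\<^sub>\<ge>\<^sub>0"
    using assms(2) i by (auto simp: nonneg_monic_system_def monic_system_def sq_integrable_def)
  \<comment> \<open>A nonnegative number is the square root of its squared modulus; for general
    complex values only the modulus of \<open>f i\<close> would result.\<close>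
  from RN nonneg have "AE x in \<mu>. sqrt_deriv (push N i \<mu>) \<mu> x = f i x"
  proof eventually_elim
    case (elim x)
    then show ?case
      by (auto simp: sqrt_deriv_def elim!: nonneg_Reals_cases)
  qed
  with \<mu> i ac f show "W_map N \<mu> (monic_op \<mu> f i a) = universal_op N i (W_map N \<mu> a)"
    using a by (rule W_map_monic_op)
qed

end
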